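(* Let $T$ be a finite tree on at least two vertices. There do not exist $v_1,v_2,v_3\in V(T)$ such that $v_1$ and $v_2$ are adjacent in $E(T)$, $v_2$ and $v_3$ are adjacent in $E(T)$, and $e_T(v_1)<e_T(v_2)<e_T(v_3)$.
   Context: For a connected simple graph $G$, $d_G$ is the graph distance and $e_G(v)=\max\{d_G(u,v):u\in V(G)\}$ is the eccentricity of $v$. A vertex $u$ is eccentric to $v$ if $d_G(u,v)=e_G(v)$. The eccentric graph $E(G)$ is the simple graph on vertex set $V(G)$ in which two distinct vertices $u,v$ are adjacent iff $u$ is eccentric to $v$ or $v$ is eccentric to $u$. *)

theory Defs
  imports "Graph_Theory.Graph_Theory"
begin

text \<open>
  A finite simple graph is a \<^locale>\<open>pair_graph\<close>: a finite vertex set with a symmetric,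
  irreflexive set of ordered pairs, each undirected edge being represented by its two arcs.
\<close>

definition graph_dist :: "'a pair_pre_digraph \<Rightarrow> 'a \<Rightarrow> 'a \<Rightarrow> nat" where
  "graph_dist G u v = (LEAST n. \<exists>p. pre_digraph.apath G u p v \<and> length p = n)"

definition eccentricity :: "'a pair_pre_digraph \<Rightarrow> 'a \<Rightarrow> nat" where
  "eccentricity G v = Max {graph_dist G u v | u. u \<in> pverts G}"

definition eccentric_to :: "'a pair_pre_digraph \<Rightarrow> 'a \<Rightarrow> 'a \<Rightarrow> bool" where
  "eccentric_to G u v \<longleftrightarrow> graph_dist G u v = eccentricity G v"

definition eccentric_graph :: "'a pair_pre_digraph \<Rightarrow> 'a pair_pre_digraph" where
  "eccentric_graph G =
     \<lparr> pverts = pverts G,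
       parcs = {(u, v). u \<in> pverts G \<and> v \<in> pverts G \<and> u \<noteq> v \<and>
                        (eccentric_to G u v \<or> eccentric_to G v u)} \<rparr>"

text \<open>
  The library predicate \<^const>\<open>tree\<close> is not usable here: its cycles are cycles of digraphs,
  so traversing an edge back and forth is a cycle and no graph with an edge would be a tree.
  In a loop-free graph these are the only digraph cycles of length less than 3; the longer ones
  are exactly the cycles of the undirected graph. Note that \<^const>\<open>connected\<close> includes that there is at least one vertex.
\<close>

definition undirected_tree :: "'a pair_pre_digraph \<Rightarrow> bool" where
  "undirected_tree G \<longleftrightarrow>
     pair_graph G \<and> connected G \<and> \<not> (\<exists>p. pre_digraph.cycle G p \<and> 3 \<le> length p)"

lemma pair_graph_eccentric_graph:
  assumes "pair_graph G"
  shows "pair_graph (eccentric_graph G)"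
proof -
  interpret pair_graph G by fact
  have "finite (parcs (eccentric_graph G))"
    by (rule finite_subset[of _ "pverts G \<times> pverts G"])
      (auto simp: eccentric_graph_def pair_finite_verts)
  then show ?thesis
    by unfold_locales
      (auto simp: eccentric_graph_def pair_finite_verts symmetric_def sym_def)
qed

lemma graph_dist_eq_shortest_path:
  assumes "pair_graph G" "u \<rightarrow>\<^sup>*\<^bsub>with_proj G\<^esub> v"
  shows "ereal (real (graph_dist G u v)) = wf_digraph.\<mu> G (\<lambda>_. 1) u v"
proof -
  interpret pair_graph G by fact
  have cost: "awalk_cost (\<lambda>_. 1) p = real (length p)" for p :: "('a \<times> 'a) list"
    by (induct p) (auto simp: awalk_cost_def)
  have ex: "\<exists>n p. apath u p v \<and> length p = n"
    using assms(2) by (simp add: reachable_apath)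
  obtain p where p: "apath u p v" "length p = graph_dist G u v"
    using LeastI_ex[OF ex] unfolding graph_dist_def by blast
  have least: "graph_dist G u v \<le> length q" if "awalk u q v" for q
  proof -
    have "apath u (awalk_to_apath q) v" using that by (rule apath_awalk_to_apath)
    then have "graph_dist G u v \<le> length (awalk_to_apath q)"
      unfolding graph_dist_def by (intro Least_le) blast
    also have "\<dots> \<le> length q" using awalk_to_path_no_neg_cyc_cost[OF that, of "\<lambda>_. 1"] by (simp add: cost)
    finally show ?thesis .
  qed
  show ?thesis
    unfolding \<mu>_def cost
  proof (rule antisym)
    show "ereal (real (graph_dist G u v)) \<le> (INF q\<in>{q. awalk u q v}. ereal (real (length q)))"
      using least by (intro INF_greatest) simp
    show "(INF q\<in>{q. awalk u q v}. ereal (real (length q))) \<le> ereal (real (graph_dist G u v))"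
      using p by (intro INF_lower2[of p]) (auto simp: apath_def)
  qed
qed

end

(* In a tree any four vertices satisfy the four-point condition
   d(v,u) + d(x,y) <= max (d(v,x) + d(u,y)) (d(v,y) + d(u,x)).
   If u is eccentric to v, then d(v,x), d(v,y) <= d(v,u), so d(x,y) <= max (d(u,y)) (d(u,x)) <= e(u):
   a vertex that is eccentric to some vertex has maximum eccentricity.
   If v1 and v2 are adjacent in E(T) and e(v1) < e(v2), then d(v1,v2) <= e(v1) < e(v2), so it must be
   v2 that is eccentric to v1; hence e(v2) is maximal and e(v3) cannot exceed it. *)
theory Submission
  imports Defs
begin

locale tree_graph = pair_graph +
  assumes connected: "connected G"
    and cycle_length: "cycle p \<Longrightarrow> length p < 3"
begin

lemma verts_reachable: "u \<in> pverts G \<Longrightarrow> v \<in> pverts G \<Longrightarrow> u \<rightarrow>\<^sup>*\<^bsub>with_proj G\<^esub> v"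
  using symmetric_connected_imp_strongly_connected[OF sym_arcs connected] by auto

text \<open>The arcs of the shortened walk are among those of \<open>p\<close>, and the start
  together with the arcs determines the vertices. Hence shortening keeps a walk off any vertex it
  already avoids.\<close>

lemma set_pawalk_verts_awalk_to_apath:
  assumes "awalk u p v"
  shows "set (pawalk_verts u (awalk_to_apath p)) \<subseteq> set (pawalk_verts u p)"
  using awalk_to_apath_subset[OF assms] set_awalk_verts[OF assms]
    set_awalk_verts[OF awalkI_apath[OF apath_awalk_to_apath[OF assms]]]
  by auto

text \<open>Induction strips equal first arcs. At the first vertex where the paths diverge, their
  remainders would close a cycle of length at least 3.\<close>

lemma apath_unique:
  assumes "apath u p v" "apath u q v"
  shows "p = q"
  using assms
proof (induction p arbitrary: u q)
  case Nil
  then show ?case using apath_nonempty_ends[of u q v] by (auto simp: apath_Nil_iff)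
next
  case (Cons e p)
  have "u \<noteq> v" using Cons.prems(1) apath_nonempty_ends by blast
  then obtain f q' where q: "q = f # q'"
    using Cons.prems(2) by (cases q) (auto simp: apath_Nil_iff)
  obtain a where e: "e = (u, a)" using Cons.prems(1) by (cases e) (auto simp: apath_Cons_iff)
  obtain b where f: "f = (u, b)" using Cons.prems(2) q by (cases f) (auto simp: apath_Cons_iff)
  have p: "(u, a) \<in> parcs G" "apath a p v" "u \<notin> set (pawalk_verts a p)"
    using Cons.prems(1) e by (auto simp: apath_Cons_iff)
  have q': "(u, b) \<in> parcs G" "apath b q' v" "u \<notin> set (pawalk_verts b q')"
    using Cons.prems(2) q f by (auto simp: apath_Cons_iff)
  show ?case
  proof (cases "a = b")
    case True
    then show ?thesis using Cons.IH p q' q e f by blast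
  next
    case False
    \<comment> \<open>The rests of the two paths join \<open>a\<close> to \<open>b\<close> avoiding \<open>u\<close>, which closes a cycle through \<open>u\<close>.\<close>
    define r where "r = p @ rev_path q'"
    have w: "awalk a p v" "awalk b q' v" using p q' by (auto intro: awalkI_apath)
    then have w': "awalk v (rev_path q') b" by simp
    have r: "awalk a r b" unfolding r_def using w(1) w' by (rule awalk_appendI)
    have "u \<notin> set (pawalk_verts a r)"
      unfolding r_def using p(3) q'(3) set_awalk_verts_append[OF w(1) w'] awalk_verts_rev_path[OF w(2)]
      by auto
    \<comment> \<open>The remainders may share more than \<open>v\<close>, so \<open>r\<close> can
      repeat vertices, while \<open>cycle\<close> requires them distinct after the first. Shortening
      \<open>r\<close> repairs this and still avoids \<open>u\<close>.\<close>
    moreover define s where "s = awalk_to_apath r"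
    ultimately have s: "apath a s b" "u \<notin> set (pawalk_verts a s)"
      using apath_awalk_to_apath[OF r] set_pawalk_verts_awalk_to_apath[OF r] by auto
    then have sw: "awalk a s b" by (auto intro: awalkI_apath)
    have s_ne: "s \<noteq> []" using s(1) False by (auto simp: apath_Nil_iff)
    have bu: "awalk b [(b, u)] u" using q'(1) arcs_symmetric
      by (auto simp: awalk_simps intro: wellformed')
    have sbu: "awalk a (s @ [(b, u)]) u" using sw bu by (rule awalk_appendI)
    have "pawalk_verts a (s @ [(b, u)]) = pawalk_verts a s @ [u]"
      using awalk_verts_append[OF sbu] sw by auto
    then have "distinct (pawalk_verts a (s @ [(b, u)]))"
      using s by (auto simp: apath_def)
    moreover have "awalk u ((u, a) # s @ [(b, u)]) u"
      using sbu p(1) by (auto simp: awalk_Cons_iff)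
    ultimately have "cycle ((u, a) # s @ [(b, u)])"
      unfolding cycle_def by (intro exI[of _ u]) auto
    \<comment> \<open>Since \<open>a\<close> and \<open>b\<close> differ, \<open>s\<close>
      contributes at least one arc besides the two at \<open>u\<close>.\<close>
    then show ?thesis using cycle_length s_ne by fastforce
  qed
qed

text \<open>By uniqueness the LEAST in \<open>graph_dist\<close> ranges over a single length, so any
  path at hand computes the distance.\<close>

lemma graph_dist_apath:
  assumes "apath u p v"
  shows "graph_dist G u v = length p"
  unfolding graph_dist_def
proof (rule Least_equality)
  show "\<exists>q. apath u q v \<and> length q = length p" using assms by blast
  show "length p \<le> n" if "\<exists>q. apath u q v \<and> length q = n" for n
    using that apath_unique[OF assms] by blast
qed

lemma graph_dist_awalk_le:
  assumes "awalk u p v"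
  shows "graph_dist G u v \<le> length p"
proof -
  have ap: "apath u (awalk_to_apath p) v" using assms by (rule apath_awalk_to_apath)
  \<comment> \<open>The arcs of the extracted path are distinct and all occur in \<open>p\<close>,
    so counting them bounds its length.\<close>
  have "distinct (awalk_to_apath p)"
    using ap distinct_verts_imp_distinct by (auto simp: apath_def)
  then have "length (awalk_to_apath p) = card (set (awalk_to_apath p))"
    by (simp add: distinct_card)
  also have "\<dots> \<le> card (set p)" using awalk_to_apath_subset[OF assms] by (simp add: card_mono)
  also have "\<dots> \<le> length p" by (rule card_length)
  finally show ?thesis using graph_dist_apath[OF ap] by simp
qed

lemma graph_dist_sym:
  assumes "u \<in> pverts G" "v \<in> pverts G"
  shows "graph_dist G u v = graph_dist G v u"
proof -
  obtain p where p: "apath u p v" using verts_reachable[OF assms] by (auto simp: reachable_apath)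
  have "length (rev_path p) = length p" by (induction p) auto
  then show ?thesis using graph_dist_apath[OF p] graph_dist_apath[of v "rev_path p" u] p by simp
qed

lemma graph_dist_triangle:
  assumes "u \<in> pverts G" "v \<in> pverts G" "w \<in> pverts G"
  shows "graph_dist G u w \<le> graph_dist G u v + graph_dist G v w"
proof -
  obtain p where p: "apath u p v" using verts_reachable[OF assms(1,2)] by (auto simp: reachable_apath)
  obtain q where q: "apath v q w" using verts_reachable[OF assms(2,3)] by (auto simp: reachable_apath)
  have "awalk u (p @ q) w" using p q by (intro awalk_appendI awalkI_apath)
  from graph_dist_awalk_le[OF this] show ?thesis
    using graph_dist_apath p q by simp
qed

lemma apath_appendI:
  assumes "apath u p v" "apath v q w"
    "set (pawalk_verts u p) \<inter> set (pawalk_verts v q) \<subseteq> {v}"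
  shows "apath u (p @ q) w"
proof -
  have "awlast u p = v" using assms(1) by (auto simp: apath_def)
  \<comment> \<open>The joint \<open>v\<close> occurs in its vertex list only at the head, so the
    remaining vertices \<open>t\<close> are disjoint from those of \<open>p\<close>.\<close>
  moreover obtain t where t: "pawalk_verts v q = v # t"
    using assms(2) awhd_of_awalk[of v q w] by (cases "pawalk_verts v q") (auto simp: apath_def)
  moreover from t have "v \<notin> set t" using assms(2) by (simp add: apath_def)
  ultimately show ?thesis unfolding apath_append_iff using assms by auto
qed

text \<open>The vertex \<open>m\<close> is where the path from \<open>v\<close> to \<open>x\<close> first meets \<open>p\<close>.\<close>

lemma apath_gate:
  assumes "apath x p y" "v \<in> pverts G"
  obtains m q r where "p = q @ r" "awalk x q m" "awalk m r y"
    "graph_dist G v x = graph_dist G v m + length q"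
    "graph_dist G v y = graph_dist G v m + length r"
proof -
  have pw: "awalk x p y" using assms(1) by (rule awalkI_apath)
  then have "x \<in> pverts G" by (rule awalk_hd_in_verts)
  then obtain s where s: "apath v s x"
    using verts_reachable[OF assms(2)] by (auto simp: reachable_apath)
  then have sw: "awalk v s x" by (rule awalkI_apath)
  \<comment> \<open>The end \<open>x\<close> of \<open>s\<close> lies on \<open>p\<close>, so a
    first meeting vertex exists; being first, it is the only vertex that the initial piece
    \<open>s1\<close> shares with \<open>p\<close>.\<close>
  have "\<exists>w \<in> set (pawalk_verts v s). w \<in> set (pawalk_verts x p)"
    using hd_in_awalk_verts(1)[OF pw] awalk_verts_non_Nil[of v s] sw
    by (metis last_in_set awalk_conv)
  from split_list_first_propE[OF this] obtain xs m ys where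
    m: "pawalk_verts v s = xs @ m # ys" "m \<in> set (pawalk_verts x p)"
      "\<forall>w \<in> set xs. w \<notin> set (pawalk_verts x p)"
    by metis
  obtain s1 s2 where s12: "s = s1 @ s2" "pawalk_verts v s1 = xs @ [m]"
    using awalk_decomp_verts[OF _ m(1), of x] sw unfolding awalk_def by metis
  obtain q r where qr: "p = q @ r" "awalk x q m" "awalk m r y"
    using awalk_decomp[OF pw m(2)] by blast
  have "awlast v s1 = m" using s12(2) by simp
  then have s1: "apath v s1 m" using s s12(1) by (simp add: apath_append_iff)
  have "awlast x q = m" using qr(2) by simp
  then have q: "apath x q m" and r: "apath m r y"
    using assms(1) qr(1) by (auto simp: apath_append_iff)
  have "set (pawalk_verts x p) = set (pawalk_verts x q) \<union> set (pawalk_verts m r)"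
    using set_awalk_verts_append[OF qr(2,3)] qr(1) by simp
  then have sub: "set (pawalk_verts v s1) \<inter> set (pawalk_verts x q) \<subseteq> {m}"
     "set (pawalk_verts v s1) \<inter> set (pawalk_verts m r) \<subseteq> {m}"
    using m(3) s12(2) by auto
  have len: "length (rev_path q) = length q" for q :: "('a \<times> 'a) list"
    by (induction q) auto
  \<comment> \<open>From \<open>m\<close>, following \<open>p\<close> backwards to \<open>x\<close>
    or forwards to \<open>y\<close> extends \<open>s1\<close> to a path, whose length is then the
    distance.\<close>
  have "apath v (s1 @ rev_path q) x"
    using sub(1) awalk_verts_rev_path[OF qr(2)] q by (intro apath_appendI[OF s1]) auto
  then have vx: "graph_dist G v x = length s1 + length q"
    using graph_dist_apath len by fastforce
  have "apath v (s1 @ r) y" using sub(2) r by (intro apath_appendI[OF s1]) auto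
  then have vy: "graph_dist G v y = length s1 + length r"
    using graph_dist_apath by fastforce
  show thesis using that[OF qr] vx vy graph_dist_apath[OF s1] by simp
qed

text \<open>Let \<open>m\<close> and \<open>n\<close> be the vertices where \<open>v\<close> and
  \<open>u\<close> attach to the path from \<open>x\<close> to \<open>y\<close>. If \<open>m\<close>
  comes first, the distances from \<open>v\<close> to \<open>y\<close> and from \<open>u\<close> to
  \<open>x\<close> both traverse the segment from \<open>m\<close> to \<open>n\<close>: one copy
  completes the path from \<open>x\<close> to \<open>y\<close>, the other joins \<open>v\<close> to
  \<open>u\<close>.\<close>

lemma four_point:
  assumes V: "u \<in> pverts G" "v \<in> pverts G" "x \<in> pverts G" "y \<in> pverts G"
  shows "graph_dist G v u + graph_dist G x y
    \<le> max (graph_dist G v x + graph_dist G u y) (graph_dist G v y + graph_dist G u x)"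
proof -
  let ?d = "graph_dist G"
  obtain p where p: "apath x p y" using verts_reachable[OF V(3,4)] by (auto simp: reachable_apath)
  have aux: "?d a b + length p \<le> ?d a y + ?d b x"
    if a: "a \<in> pverts G" "p = q1 @ r1" "awalk x q1 m" "awalk m r1 y" "?d a y = ?d a m + length r1"
      and b: "b \<in> pverts G" "p = q2 @ r2" "awalk x q2 n" "awalk n r2 y" "?d b x = ?d b n + length q2"
      and le: "length q1 \<le> length q2" for a b m n q1 r1 q2 r2
  proof -
    \<comment> \<open>\<open>t\<close> is the segment of \<open>p\<close> between the two attachment
      vertices.\<close>
    obtain t where t: "q2 = q1 @ t"
      using le a(2) b(2) by (auto simp: append_eq_append_conv2)
    have "awalk m t n" using b(3) a(3) unfolding t by simp
    then have mn: "?d m n \<le> length t" by (rule graph_dist_awalk_le)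
    have "m \<in> pverts G" "n \<in> pverts G" using a(4) b(4) by (auto simp: awalk_def)
    then have "?d a b \<le> ?d a m + (?d m n + ?d b n)"
      using graph_dist_triangle[of a m b] graph_dist_triangle[of m n b] graph_dist_sym[of b n] a(1) b(1)
      by linarith
    then show ?thesis using mn a(2,5) b(2,5) t by simp
  qed
  obtain m q1 r1 where 1: "p = q1 @ r1" "awalk x q1 m" "awalk m r1 y"
    "?d v x = ?d v m + length q1" "?d v y = ?d v m + length r1"
    using apath_gate[OF p V(2)] by metis
  obtain n q2 r2 where 2: "p = q2 @ r2" "awalk x q2 n" "awalk n r2 y"
    "?d u x = ?d u n + length q2" "?d u y = ?d u n + length r2"
    using apath_gate[OF p V(1)] by metis
  \<comment> \<open>The two disjuncts correspond to the two possible orders of \<open>m\<close> and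
    \<open>n\<close> along \<open>p\<close>.\<close>
  have "?d v u + length p \<le> ?d v y + ?d u x \<or> ?d u v + length p \<le> ?d u y + ?d v x"
    using aux[OF V(2) 1(1-3,5) V(1) 2(1-4)] aux[OF V(1) 2(1-3,5) V(2) 1(1-4)] by linarith
  then show ?thesis using graph_dist_apath[OF p] graph_dist_sym[OF V(1,2)] by linarith
qed

lemma graph_dist_le_eccentricity:
  assumes "u \<in> pverts G"
  shows "graph_dist G u v \<le> eccentricity G v"
  unfolding eccentricity_def using assms pair_finite_verts by (intro Max_ge) auto

text \<open>The vertex \<open>v\<close> itself makes the set under \<open>Max\<close>
  nonempty.\<close>

lemma eccentricity_le_iff:
  assumes "v \<in> pverts G"
  shows "eccentricity G v \<le> n \<longleftrightarrow> (\<forall>u \<in> pverts G. graph_dist G u v \<le> n)"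
  unfolding eccentricity_def using assms pair_finite_verts by (subst Max_le_iff) auto

lemma eccentricity_le_of_eccentric_to:
  assumes "eccentric_to G u v" "u \<in> pverts G" "v \<in> pverts G" "x \<in> pverts G"
  shows "eccentricity G x \<le> eccentricity G u"
  unfolding eccentricity_le_iff[OF assms(4)]
proof
  fix y assume y: "y \<in> pverts G"
  let ?d = "graph_dist G"
  have vu: "?d v u = eccentricity G v"
    using assms graph_dist_sym[of u v] by (simp add: eccentric_to_def)
  \<comment> \<open>\<open>eccentricity\<close> maximises over the first argument of
    \<open>graph_dist\<close>; symmetry turns this into bounds on distances from \<open>v\<close>
    and from \<open>u\<close>.\<close>
  have ecc: "?d v z \<le> ?d v u" "?d u z \<le> eccentricity G u" if "z \<in> pverts G" for z
    using graph_dist_le_eccentricity[OF that] graph_dist_sym[OF that] assms(2,3) vu by metis+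
  show "?d y x \<le> eccentricity G u"
    using four_point[OF assms(2,3,4) y] ecc[OF assms(4)] ecc[OF y] graph_dist_sym[OF assms(4) y]
    by linarith
qed

text \<open>An edge of the eccentric graph leaves open which end is eccentric to the other; the
  strict inequality decides it.\<close>

lemma eccentric_to_of_eccentricity_less:
  assumes "u \<rightarrow>\<^bsub>eccentric_graph G\<^esub> v" "eccentricity G u < eccentricity G v"
  shows "eccentric_to G v u"
proof -
  have V: "u \<in> pverts G" "v \<in> pverts G" and "eccentric_to G u v \<or> eccentric_to G v u"
    using assms(1) by (auto simp: eccentric_graph_def)
  moreover have "\<not> eccentric_to G u v"
    using graph_dist_le_eccentricity[OF V(2), of u] graph_dist_sym[OF V] assms(2)
    by (simp add: eccentric_to_def)
  ultimately show ?thesis by blast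
qed

end

lemma undirected_tree_imp_tree_graph:
  assumes "undirected_tree G"
  shows "tree_graph G"
  using assms unfolding undirected_tree_def tree_graph_def tree_graph_axioms_def
  by (auto simp: not_le[symmetric])

theorem proposition1:
  fixes T :: "'a pair_pre_digraph"
  assumes "undirected_tree T" and "2 \<le> card (pverts T)"
  shows "\<not> (\<exists>v1 \<in> pverts T. \<exists>v2 \<in> pverts T. \<exists>v3 \<in> pverts T.
            v1 \<rightarrow>\<^bsub>eccentric_graph T\<^esub> v2 \<and> v2 \<rightarrow>\<^bsub>eccentric_graph T\<^esub> v3 \<and>
            eccentricity T v1 < eccentricity T v2 \<and> eccentricity T v2 < eccentricity T v3)"
proof -
  interpret tree_graph T using assms(1) by (rule undirected_tree_imp_tree_graph)
  show ?thesis
    using eccentric_to_of_eccentricity_less eccentricity_le_of_eccentric_to by (meson not_le)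
qed

end
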